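(* Let $G$ be a bicyclic graph of order $n$. Then $$HSO(G)\leq (n-4)\sqrt{n^2-2n+2}+\sqrt{n^2-2n+5}+\frac{1}{3}\sqrt{n^2-2n+10}+\sqrt{13},$$ with equality if and only if $G\cong S''_n$.
   Context: All graphs are finite, simple and connected. For a graph $G$ with edge set $E(G)$, $d_i$ denotes the degree of the vertex $v_i$, and the Hyperbolic Sombor index is $HSO(G)=\sum_{v_iv_j\in E(G)}\frac{\sqrt{d_i^2+d_j^2}}{\min\{d_i,d_j\}}$. A bicyclic graph of order $n$ is a connected graph with $n$ vertices and $n+1$ edges. $S''_n$ denotes the connected bicyclic graph of order $n$ constructed from $K_4-e$ (where $e$ is any edge of the complete graph $K_4$) by attaching $n-4$ pendent edges to one of its vertices of degree $3$. *)

theory Defs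
  imports Complex_Main "Graph_Theory.Graph_Theory"
begin

text \<open>
  A finite simple graph is a \<^locale>\<open>pair_graph\<close>: a finite loop-free digraph whose arc relation is
  symmetric. Each undirected edge \<open>uv\<close> is thus represented by the two arcs \<open>(u, v)\<close> and \<open>(v, u)\<close>, so
  edges have to be counted, and summed over, as unordered pairs, while the degree of a vertex is its
  out-degree.
\<close>

definition edges :: "'a pair_pre_digraph \<Rightarrow> 'a set set" where
  "edges G = {{u, v} | u v. (u, v) \<in> parcs G}"

definition degree :: "'a pair_pre_digraph \<Rightarrow> 'a \<Rightarrow> nat" where
  "degree G v = out_degree (with_proj G) v"

text \<open>As \<open>G\<close> has no loops, each \<open>e \<in> edges G\<close> consists of the two distinct end vertices of the edge.\<close>

definition HSO :: "'a pair_pre_digraph \<Rightarrow> real" where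
  "HSO G = (\<Sum>e\<in>edges G. sqrt (\<Sum>v\<in>e. (real (degree G v))\<^sup>2) / real (Min (degree G ` e)))"

definition bicyclic_graph :: "'a pair_pre_digraph \<Rightarrow> nat \<Rightarrow> bool" where
  "bicyclic_graph G n \<longleftrightarrow> pair_graph G \<and> Digraph_Component.connected (with_proj G) \<and>
     card (pverts G) = n \<and> card (edges G) = n + 1"

abbreviation graph_iso :: "'a pair_pre_digraph \<Rightarrow> 'b pair_pre_digraph \<Rightarrow> bool" where
  "graph_iso G H \<equiv> digraph_iso (with_proj G) (with_proj H)"

text \<open>\<open>K\<^sub>4 - e\<close> on the vertices \<open>0, 1, 2, 3\<close>, with \<open>e = {2, 3}\<close>; the vertices of degree 3 are 0 and 1.\<close>

definition K4_minus_edge :: "nat pair_pre_digraph" where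
  "K4_minus_edge = \<lparr> pverts = {0, 1, 2, 3},
     parcs = {(u, v). u \<in> {0, 1, 2, 3} \<and> v \<in> {0, 1, 2, 3} \<and> u \<noteq> v \<and> {u, v} \<noteq> {2, 3}} \<rparr>"

text \<open>\<open>W\<close> is the set of the new pendent vertices; it is meant to be disjoint from \<open>pverts G\<close>.\<close>

definition attach_pendent :: "'a pair_pre_digraph \<Rightarrow> 'a \<Rightarrow> 'a set \<Rightarrow> 'a pair_pre_digraph" where
  "attach_pendent G v W = \<lparr> pverts = pverts G \<union> W, parcs = parcs G \<union> {v} \<times> W \<union> W \<times> {v} \<rparr>"

text \<open>The graph \<open>S''\<^sub>n\<close>, for \<open>n \<ge> 4\<close>.\<close>

definition S_bicyclic :: "nat \<Rightarrow> nat pair_pre_digraph" where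
  "S_bicyclic n = attach_pendent K4_minus_edge 0 {4..<n}"

end

theory Submission
  imports Defs
begin

text \<open>
  An edge whose ends have degrees with ratio \<open>t \<ge> 1\<close> weighs \<open>sqrt (1 + t\<^sup>2)\<close>. The index is therefore large
  when many pendent edges meet in one vertex of large degree, and a bicyclic graph can concentrate its
  edges no further than by having a vertex of degree \<open>n - 1\<close>.

  If such a vertex exists, the graph is a star with two further edges. Either these share a vertex and
  the graph is \<open>S''\<^sub>n\<close>, or they are disjoint and the index is strictly smaller
  (\<open>hso_dominating_vertex\<close>). The unique bicyclic graph on four vertices belongs to this case.

  If no such vertex exists, the inequality is strict. Without pendent vertices the degrees lie between 2
  and 4, so every edge weighs at most \<open>sqrt 5\<close>, which is too little (\<open>hso_no_pendant\<close>). Otherwise a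
  pendent vertex is deleted and induction applies. Its neighbour has a degree \<open>d \<le> n - 2\<close>, and the deletion
  costs at most \<open>sqrt (d\<^sup>2 + 1)\<close> for the edge itself and, for each of the other \<open>d - 1\<close> edges at the
  neighbour, at most the decrease \<open>sqrt (d\<^sup>2 + 1) - sqrt ((d - 1)\<^sup>2 + 1)\<close> of a pendent edge
  (\<open>hso_delete_pendant\<close>). This cost grows with \<open>d\<close>, and already at \<open>d = n - 2\<close> it is less than the
  difference between the values claimed for \<open>n\<close> and \<open>n - 1\<close> (\<open>extremal_value_step\<close>).
\<close>

section \<open>Edge sets and the value of the extremal graph\<close>

text \<open>Graphs are handled as a vertex set \<open>V\<close> together with a set \<open>E\<close> of two-element sets, since this is
  the form in which the index sums over edges and in which deleting an edge is a set difference.\<close>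

definition vdeg :: "'a set set \<Rightarrow> 'a \<Rightarrow> nat" where
  "vdeg E v = card {e \<in> E. v \<in> e}"

text \<open>Stated for an arbitrary degree function \<open>d\<close>, so that one edge can be weighed before and after a
  deletion.\<close>

definition edge_weight :: "('a \<Rightarrow> nat) \<Rightarrow> 'a set \<Rightarrow> real" where
  "edge_weight d e = sqrt (\<Sum>v\<in>e. (real (d v))\<^sup>2) / real (Min (d ` e))"

definition hso :: "'a set set \<Rightarrow> real" where
  "hso E = (\<Sum>e\<in>E. edge_weight (vdeg E) e)"

text \<open>Connectedness is expressed by cuts: every proper nonempty vertex set is left by some edge. This
  form passes to the graph without a pendent vertex by a single case distinction.\<close>

definition connected_graph :: "'a set \<Rightarrow> 'a set set \<Rightarrow> bool" where
  "connected_graph V E \<longleftrightarrow> finite V \<and> (\<forall>e\<in>E. e \<subseteq> V \<and> card e = 2) \<and>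
     (\<forall>S. S \<subseteq> V \<longrightarrow> S \<noteq> {} \<longrightarrow> S \<noteq> V \<longrightarrow> (\<exists>e\<in>E. e \<inter> S \<noteq> {} \<and> e - S \<noteq> {}))"

definition star :: "'a set \<Rightarrow> 'a \<Rightarrow> 'a set set" where
  "star V c = (\<lambda>x. {c, x}) ` (V - {c})"

text \<open>The graph \<open>S''\<^sub>n\<close>: a vertex \<open>c\<close> joined to all others, and a path \<open>z - y - t\<close> on its neighbours.\<close>

definition is_S_bicyclic :: "'a set \<Rightarrow> 'a set set \<Rightarrow> bool" where
  "is_S_bicyclic V E \<longleftrightarrow> (\<exists>c y z t. distinct [c, y, z, t] \<and> {c, y, z, t} \<subseteq> V \<and>
     E = star V c \<union> {{y, z}, {y, t}})"

text \<open>The edge weight in terms of the two degrees, over the reals so that it can be estimated analytically.\<close>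

definition degree_weight :: "real \<Rightarrow> real \<Rightarrow> real" where
  "degree_weight a b = sqrt (a\<^sup>2 + b\<^sup>2) / min a b"

text \<open>The index of \<open>S''\<^sub>n\<close>, as a function of the degree \<open>x = n - 1\<close> of its centre.\<close>

definition extremal_value :: "real \<Rightarrow> real" where
  "extremal_value x = (x - 3) * sqrt (x\<^sup>2 + 1) + sqrt (x\<^sup>2 + 4) + 1 / 3 * sqrt (x\<^sup>2 + 9) + sqrt 13"

section \<open>Inequalities between square roots\<close>

lemma sqrt_diff_eq:
  fixes x y c :: real
  assumes "c > 0"
  shows "sqrt (x\<^sup>2 + c) - sqrt (y\<^sup>2 + c) = (x\<^sup>2 - y\<^sup>2) / (sqrt (x\<^sup>2 + c) + sqrt (y\<^sup>2 + c))"
proof -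
  have p: "sqrt (x\<^sup>2 + c) > 0" "sqrt (y\<^sup>2 + c) > 0"
    using assms by (auto intro!: add_nonneg_pos)
  have "(sqrt (x\<^sup>2 + c) - sqrt (y\<^sup>2 + c)) * (sqrt (x\<^sup>2 + c) + sqrt (y\<^sup>2 + c)) = x\<^sup>2 - y\<^sup>2"
    using assms by (simp add: algebra_simps flip: power2_eq_square)
  moreover have "sqrt (x\<^sup>2 + c) + sqrt (y\<^sup>2 + c) \<noteq> 0" using p by linarith
  ultimately show ?thesis by (simp add: eq_divide_eq)
qed

text \<open>When the degree of one end drops from \<open>d\<close> to \<open>d - 1\<close>, the weight of an edge falls by at most what it
  falls when the other end has degree 1. If the other degree \<open>a\<close> is the smaller one, the fall is
  \<open>(2 d - 1) / (a (sqrt (d\<^sup>2 + a\<^sup>2) + sqrt ((d - 1)\<^sup>2 + a\<^sup>2)))\<close>, which decreases in \<open>a\<close>; otherwise the weight does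
  not fall, because the ratio of the two degrees grows. The last assumption holds for all integers.\<close>

lemma degree_weight_step:
  fixes d a :: real
  assumes "d \<ge> 2" "a \<ge> 1" "a \<le> d - 1 \<or> d \<le> a"
  shows "degree_weight d a - degree_weight (d - 1) a \<le> sqrt (d\<^sup>2 + 1) - sqrt ((d - 1)\<^sup>2 + 1)"
  using assms(3)
proof
  assume le: "a \<le> d - 1"
  have a2: "a\<^sup>2 \<ge> 1" using assms by simp
  have sq: "d\<^sup>2 - (d - 1)\<^sup>2 \<ge> 0" using assms by (simp add: power2_eq_square algebra_simps)
  have "degree_weight d a - degree_weight (d - 1) a = (sqrt (d\<^sup>2 + a\<^sup>2) - sqrt ((d - 1)\<^sup>2 + a\<^sup>2)) / a"
    using le by (simp add: degree_weight_def diff_divide_distrib)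
  also have "\<dots> \<le> sqrt (d\<^sup>2 + a\<^sup>2) - sqrt ((d - 1)\<^sup>2 + a\<^sup>2)"
  proof -
    have "sqrt (d\<^sup>2 + a\<^sup>2) - sqrt ((d - 1)\<^sup>2 + a\<^sup>2) \<ge> 0" using sq by simp
    then show ?thesis using assms divide_left_mono[of 1 a] by simp
  qed
  also have "\<dots> = (d\<^sup>2 - (d - 1)\<^sup>2) / (sqrt (d\<^sup>2 + a\<^sup>2) + sqrt ((d - 1)\<^sup>2 + a\<^sup>2))"
    using a2 by (intro sqrt_diff_eq) auto
  also have "\<dots> \<le> (d\<^sup>2 - (d - 1)\<^sup>2) / (sqrt (d\<^sup>2 + 1) + sqrt ((d - 1)\<^sup>2 + 1))"
    using a2 sq by (intro divide_left_mono add_mono mult_pos_pos add_pos_pos) (auto intro!: add_nonneg_pos)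
  also have "\<dots> = sqrt (d\<^sup>2 + 1) - sqrt ((d - 1)\<^sup>2 + 1)"
    by (intro sqrt_diff_eq[symmetric]) auto
  finally show ?thesis .
next
  assume le: "d \<le> a"
  have *: "degree_weight x a = sqrt (1 + (a / x)\<^sup>2)" if "0 < x" "x \<le> a" for x
  proof -
    have "degree_weight x a = sqrt ((x\<^sup>2 + a\<^sup>2) / x\<^sup>2)"
      using that by (simp add: degree_weight_def real_sqrt_divide)
    also have "(x\<^sup>2 + a\<^sup>2) / x\<^sup>2 = 1 + (a / x)\<^sup>2"
      using that by (simp add: field_simps)
    finally show ?thesis .
  qed
  have "a / d \<le> a / (d - 1)" using assms by (intro divide_left_mono) auto
  then have "degree_weight d a \<le> degree_weight (d - 1) a"
    using assms le by (simp add: *)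
  moreover have "sqrt ((d - 1)\<^sup>2 + 1) \<le> sqrt (d\<^sup>2 + 1)" using assms by simp
  ultimately show ?thesis by linarith
qed

text \<open>Convexity of \<open>x \<mapsto> sqrt (x\<^sup>2 + 1)\<close>, which is the triangle inequality for the plane vectors \<open>(k, 1)\<close> and
  \<open>(k + 2, 1)\<close>, whose sum is \<open>2 (k + 1, 1)\<close>.\<close>

lemma sqrt_step_mono:
  assumes "i \<le> j"
  shows "sqrt ((real i + 1)\<^sup>2 + 1) - sqrt ((real i)\<^sup>2 + 1) \<le> sqrt ((real j + 1)\<^sup>2 + 1) - sqrt ((real j)\<^sup>2 + 1)"
proof (rule lift_Suc_mono_le[OF _ assms])
  fix k :: nat
  have "sqrt ((real k + (real k + 2))\<^sup>2 + (1 + 1)\<^sup>2) \<le> sqrt ((real k)\<^sup>2 + 1\<^sup>2) + sqrt ((real k + 2)\<^sup>2 + 1\<^sup>2)"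
    by (rule real_sqrt_sum_squares_triangle_ineq)
  moreover have "(real k + (real k + 2))\<^sup>2 + (1 + 1)\<^sup>2 = 2\<^sup>2 * ((real k + 1)\<^sup>2 + 1)"
    by (simp add: power2_eq_square algebra_simps)
  moreover have "sqrt (2\<^sup>2 * ((real k + 1)\<^sup>2 + 1)) = 2 * sqrt ((real k + 1)\<^sup>2 + 1)"
    by (simp only: real_sqrt_mult) simp
  moreover have "real (Suc k) = real k + 1" "real (Suc k) + 1 = real k + 2" by simp_all
  ultimately show "sqrt ((real k + 1)\<^sup>2 + 1) - sqrt ((real k)\<^sup>2 + 1)
      \<le> sqrt ((real (Suc k) + 1)\<^sup>2 + 1) - sqrt ((real (Suc k))\<^sup>2 + 1)"
    by (simp only: power_one)
qed

lemma sqrt_step_less_one: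
  fixes x :: real
  assumes "x \<ge> 1"
  shows "sqrt (x\<^sup>2 + 1) < sqrt ((x - 1)\<^sup>2 + 1) + 1"
proof (rule real_less_lsqrt)
  have "x - 1 < sqrt ((x - 1)\<^sup>2 + 1)" by (rule real_less_rsqrt) simp
  then show "x\<^sup>2 + 1 < (sqrt ((x - 1)\<^sup>2 + 1) + 1)\<^sup>2"
    by (simp add: power2_eq_square algebra_simps)
qed (auto intro!: add_nonneg_nonneg)

text \<open>The last assumption is the conclusion squared twice.\<close>

lemma sqrt_step_ge:
  fixes x c a :: real
  assumes "0 \<le> a" "0 \<le> c" "0 \<le> 2 * x - 1 - a\<^sup>2"
    and "4 * a\<^sup>2 * ((x - 1)\<^sup>2 + c) \<le> (2 * x - 1 - a\<^sup>2)\<^sup>2"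
  shows "sqrt ((x - 1)\<^sup>2 + c) + a \<le> sqrt (x\<^sup>2 + c)"
proof (rule real_le_rsqrt)
  have "(2 * a * sqrt ((x - 1)\<^sup>2 + c))\<^sup>2 \<le> (2 * x - 1 - a\<^sup>2)\<^sup>2"
    using assms by (simp add: power_mult_distrib)
  then have "2 * a * sqrt ((x - 1)\<^sup>2 + c) \<le> 2 * x - 1 - a\<^sup>2"
    using assms(3) by (rule power2_le_imp_le)
  moreover have "(sqrt ((x - 1)\<^sup>2 + c) + a)\<^sup>2 = (x - 1)\<^sup>2 + c + 2 * a * sqrt ((x - 1)\<^sup>2 + c) + a\<^sup>2"
    using assms by (simp add: power2_sum)
  ultimately show "(sqrt ((x - 1)\<^sup>2 + c) + a)\<^sup>2 \<le> x\<^sup>2 + c"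
    by (simp add: power2_eq_square algebra_simps)
qed

text \<open>This is the induction step for a pendent vertex whose neighbour has degree at most \<open>n - 2 = x - 1\<close>. With
  \<open>D = sqrt (x\<^sup>2 + 1) - sqrt ((x - 1)\<^sup>2 + 1)\<close>, the increase of the extremal value from \<open>x - 1\<close> to \<open>x\<close> is
  \<open>sqrt ((x - 1)\<^sup>2 + 1) + (x - 3) D\<close> plus the increment of \<open>sqrt (x\<^sup>2 + 4)\<close> plus a third of the increment of
  \<open>sqrt (x\<^sup>2 + 9)\<close>. It therefore suffices that the last two terms together exceed \<open>D\<close>. They are at least
  \<open>5 / 6\<close> and \<open>1 / 4\<close>, with sum above 1, while \<open>D < 1\<close>.\<close>

lemma extremal_value_step:
  fixes x :: real
  assumes "x \<ge> 4"
  shows "extremal_value (x - 1) + sqrt ((x - 1)\<^sup>2 + 1)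
    + (x - 2) * (sqrt (x\<^sup>2 + 1) - sqrt ((x - 1)\<^sup>2 + 1)) < extremal_value x"
proof -
  (* In y all coefficients of the polynomial inequalities below are nonnegative. *)
  define y where "y = x - 4"
  have y: "y \<ge> 0" "y * y \<ge> 0" "x = 4 + y" using assms by (simp_all add: y_def)
  have "sqrt ((x - 1)\<^sup>2 + 4) + 5 / 6 \<le> sqrt (x\<^sup>2 + 4)"
    using y(1,2) unfolding y(3) by (intro sqrt_step_ge) (auto simp: power2_eq_square field_simps)
  moreover have "sqrt ((x - 1)\<^sup>2 + 9) + 3 / 4 \<le> sqrt (x\<^sup>2 + 9)"
    using y(1,2) unfolding y(3) by (intro sqrt_step_ge) (auto simp: power2_eq_square field_simps)
  moreover have "sqrt (x\<^sup>2 + 1) < sqrt ((x - 1)\<^sup>2 + 1) + 1"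
    using assms by (intro sqrt_step_less_one) auto
  ultimately show ?thesis by (simp add: extremal_value_def algebra_simps)
qed

text \<open>If there is no pendent vertex, each of the \<open>n + 1\<close> edges weighs at most \<open>sqrt 5\<close>. Replacing the roots
  of the extremal value that involve \<open>n\<close> by \<open>n - 1\<close> suffices from \<open>n = 6\<close> on; \<open>n = 5\<close> is checked numerically.\<close>

lemma extremal_value_gt_no_pendant:
  assumes "n \<ge> 5"
  shows "(real n + 1) * sqrt 5 < extremal_value (real n - 1)"
proof -
  have s5: "sqrt 5 < (224 / 100)" by (rule real_less_lsqrt) (auto simp: power2_eq_square)
  have s13: "sqrt 13 > 3.6" by (rule real_less_rsqrt) (auto simp: power2_eq_square)
  show ?thesis
  proof (cases "n = 5")
    case True
    have "sqrt 17 > 4.12" by (rule real_less_rsqrt) (auto simp: power2_eq_square)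
    moreover have "sqrt 20 > 4.47" by (rule real_less_rsqrt) (auto simp: power2_eq_square)
    moreover have "sqrt 25 = (5::real)" by (rule real_sqrt_unique) auto
    ultimately show ?thesis using True s5 s13 by (simp add: extremal_value_def)
  next
    case False
    define x where "x = real n - 1"
    have x: "x \<ge> 5" using False assms by (simp add: x_def)
    have g: "sqrt (x\<^sup>2 + c) \<ge> x" if "c \<ge> 0" for c using that by (intro real_le_rsqrt) auto
    have "(x - 3) * x \<le> (x - 3) * sqrt (x\<^sup>2 + 1)" using x g[of 1] by (intro mult_left_mono) auto
    then have 1: "(x - 3) * x + x + x / 3 + 3.6 < extremal_value x"
      using g[of 4] g[of 9] s13 by (simp add: extremal_value_def)
    have 2: "(x + 2) * sqrt 5 \<le> (x + 2) * (224 / 100)" using x s5 by (intro mult_left_mono) auto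
    have "5 * x \<le> x * x" using x by (intro mult_right_mono) auto
    then have "(x + 2) * (224 / 100) \<le> (x - 3) * x + x + x / 3 + 3.6"
      using x unfolding left_diff_distrib distrib_right by linarith
    then have "(x + 2) * sqrt 5 < extremal_value x" using 1 2 by linarith
    then show ?thesis by (simp add: x_def algebra_simps)
  qed
qed

text \<open>The left side is the index of two triangles with a common vertex that carries \<open>n - 5\<close> pendent edges.\<close>

lemma extremal_value_gt_matching:
  fixes x :: real
  assumes "x \<ge> 4"
  shows "(x - 4) * sqrt (x\<^sup>2 + 1) + 2 * sqrt (x\<^sup>2 + 4) + 2 * sqrt 2 < extremal_value x"
proof -
  have "sqrt 2 < 1.415" by (rule real_less_lsqrt) (auto simp: power2_eq_square)
  moreover have "sqrt 13 > 3.6" by (rule real_less_rsqrt) (auto simp: power2_eq_square)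
  moreover have "sqrt (x\<^sup>2 + 9) \<ge> x" by (intro real_le_rsqrt) auto
  moreover have "sqrt (x\<^sup>2 + 4) \<le> sqrt (x\<^sup>2 + 1) + 1"
  proof (rule real_le_lsqrt)
    have "x \<le> sqrt (x\<^sup>2 + 1)" by (rule real_le_rsqrt) simp
    then show "x\<^sup>2 + 4 \<le> (sqrt (x\<^sup>2 + 1) + 1)\<^sup>2" using assms by (simp add: power2_sum)
  qed (auto intro!: add_nonneg_nonneg)
  ultimately show ?thesis using assms by (simp add: extremal_value_def algebra_simps)
qed

section \<open>Degrees in bicyclic graphs\<close>

lemma edge_weight_doubleton:
  assumes "u \<noteq> v"
  shows "edge_weight d {u, v} = degree_weight (real (d u)) (real (d v))"
  using assms by (simp add: edge_weight_def degree_weight_def of_nat_min)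

lemma degree_weight_commute: "degree_weight a b = degree_weight b a"
  by (simp add: degree_weight_def add.commute min.commute)

lemma finite_edges:
  assumes "finite V" "\<forall>e\<in>E. e \<subseteq> V \<and> card e = 2"
  shows "finite E"
  using assms by (intro finite_subset[of E "Pow V"]) auto

lemma handshake:
  assumes "finite V" "\<forall>e\<in>E. e \<subseteq> V \<and> card e = 2"
  shows "(\<Sum>v\<in>V. vdeg E v) = 2 * card E"
proof -
  have fE: "finite E" using assms by (rule finite_edges)
  have "(\<Sum>v\<in>V. vdeg E v) = (\<Sum>v\<in>V. \<Sum>e\<in>{e\<in>E. v \<in> e}. 1)"
    by (simp add: vdeg_def)
  also have "\<dots> = (\<Sum>e\<in>E. \<Sum>v\<in>{v\<in>V. v \<in> e}. 1)"
    using assms fE by (intro sum.swap_restrict)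
  also have "\<dots> = (\<Sum>e\<in>E. 2)"
  proof (intro sum.cong refl)
    fix e assume "e \<in> E"
    then have "{v \<in> V. v \<in> e} = e" "card e = 2" using assms by auto
    then show "(\<Sum>v\<in>{v \<in> V. v \<in> e}. 1) = (2::nat)" by simp
  qed
  finally show ?thesis by simp
qed

lemma vdeg_eq_card_nbrs:
  assumes "\<forall>e\<in>E. e \<subseteq> V \<and> card e = 2"
  shows "vdeg E v = card {x \<in> V - {v}. {v, x} \<in> E}"
proof -
  have "{e \<in> E. v \<in> e} = (\<lambda>x. {v, x}) ` {x \<in> V - {v}. {v, x} \<in> E}"
  proof (intro set_eqI iffI)
    fix e assume e: "e \<in> {e \<in> E. v \<in> e}"
    then obtain a b where ab: "e = {a, b}" "a \<noteq> b" using assms by (auto simp: card_2_iff)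
    then have "e = {v, if v = a then b else a}" using e by auto
    then show "e \<in> (\<lambda>x. {v, x}) ` {x \<in> V - {v}. {v, x} \<in> E}"
      using e ab assms by (intro image_eqI[of _ _ "if v = a then b else a"]) auto
  qed auto
  moreover have "inj_on (\<lambda>x. {v, x}) {x \<in> V - {v}. {v, x} \<in> E}"
    by (auto simp: inj_on_def doubleton_eq_iff)
  ultimately show ?thesis by (simp add: vdeg_def card_image)
qed

lemma vdeg_le:
  assumes "finite V" "\<forall>e\<in>E. e \<subseteq> V \<and> card e = 2" "v \<in> V"
  shows "vdeg E v \<le> card V - 1"
proof -
  have "card {x \<in> V - {v}. {v, x} \<in> E} \<le> card (V - {v})"
    using assms by (intro card_mono) auto
  then show ?thesis using assms by (simp add: vdeg_eq_card_nbrs[of E V])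
qed

lemma vdeg_ge_1:
  assumes "connected_graph V E" "v \<in> V" "card V \<ge> 2"
  shows "vdeg E v \<ge> 1"
proof -
  have "{v} \<noteq> V" using assms(3) by auto
  then obtain e where "e \<in> E" "e \<inter> {v} \<noteq> {}"
    using assms unfolding connected_graph_def by (metis bot.extremum empty_not_insert insert_subset)
  then have "{e \<in> E. v \<in> e} \<noteq> {}" by auto
  moreover have "finite {e \<in> E. v \<in> e}"
    using assms finite_edges[of V E] by (auto simp: connected_graph_def)
  ultimately show ?thesis by (simp add: vdeg_def card_gt_0_iff Suc_le_eq)
qed

text \<open>The degree sum \<open>2 (n + 1)\<close> is at most \<open>n (n - 1)\<close>, which fails for \<open>n < 4\<close>.\<close>

lemma bicyclic_card_ge_4:
  assumes "connected_graph V E" "card E = card V + 1"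
  shows "card V \<ge> 4"
proof -
  have *: "finite V" "\<forall>e\<in>E. e \<subseteq> V \<and> card e = 2" using assms by (auto simp: connected_graph_def)
  have "(\<Sum>v\<in>V. vdeg E v) \<le> (\<Sum>v\<in>V. card V - 1)"
    by (intro sum_mono vdeg_le *)
  then have "2 * (card V + 1) \<le> card V * (card V - 1)" using handshake[OF *] assms by simp
  moreover have "\<not> 2 * (k + 1) \<le> k * (k - 1)" if "k < 4" for k :: nat
  proof -
    have "k = 0 \<or> k = 1 \<or> k = 2 \<or> k = 3" using that by auto
    then show ?thesis by auto
  qed
  ultimately show ?thesis by (meson not_le)
qed

section \<open>Graphs with a vertex adjacent to all others\<close>

text \<open>Joining \<open>c\<close> to every vertex of a graph \<open>M\<close> raises all degrees of \<open>M\<close> by one, so the index splits into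
  the spokes, indexed by their outer end, and the edges of \<open>M\<close>.\<close>

lemma hso_cone:
  assumes V: "finite V" "c \<in> V" and M: "\<forall>e\<in>M. e \<subseteq> V - {c} \<and> card e = 2"
  shows "hso (star V c \<union> M) =
      (\<Sum>x\<in>V - {c}. degree_weight (real (card V - 1)) (real (vdeg M x + 1)))
      + (\<Sum>e\<in>M. edge_weight (\<lambda>x. vdeg M x + 1) e)"
proof -
  have inj: "inj_on (\<lambda>x. {c, x}) (V - {c})" by (auto simp: inj_on_def doubleton_eq_iff)
  have fM: "finite M" using V M by (intro finite_edges[of "V - {c}"]) auto
  have "{e \<in> star V c \<union> M. c \<in> e} = star V c" using M by (auto simp: star_def)
  then have c: "vdeg (star V c \<union> M) c = card V - 1"
    using V inj by (simp add: vdeg_def star_def card_image)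
  have x: "vdeg (star V c \<union> M) x = vdeg M x + 1" if x: "x \<in> V - {c}" for x
  proof -
    have "{e \<in> star V c \<union> M. x \<in> e} = insert {c, x} {e \<in> M. x \<in> e}"
      using x by (auto simp: star_def)
    moreover have "{c, x} \<notin> {e \<in> M. x \<in> e}" using M by auto
    ultimately show ?thesis using fM by (simp add: vdeg_def)
  qed
  have disj: "star V c \<inter> M = {}" using M by (auto simp: star_def)
  have "hso (star V c \<union> M) = (\<Sum>e\<in>star V c. edge_weight (vdeg (star V c \<union> M)) e)
      + (\<Sum>e\<in>M. edge_weight (vdeg (star V c \<union> M)) e)"
    unfolding hso_def using V fM disj by (intro sum.union_disjoint) (auto simp: star_def)
  also have "(\<Sum>e\<in>star V c. edge_weight (vdeg (star V c \<union> M)) e)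
      = (\<Sum>x\<in>V - {c}. edge_weight (vdeg (star V c \<union> M)) {c, x})"
    using inj by (simp add: star_def sum.reindex)
  also have "\<dots> = (\<Sum>x\<in>V - {c}. degree_weight (real (card V - 1)) (real (vdeg M x + 1)))"
    using c x by (intro sum.cong refl) (subst edge_weight_doubleton, auto)
  also have "(\<Sum>e\<in>M. edge_weight (vdeg (star V c \<union> M)) e)
      = (\<Sum>e\<in>M. edge_weight (\<lambda>x. vdeg M x + 1) e)"
  proof (intro sum.cong refl)
    fix e assume "e \<in> M"
    then obtain a b where ab: "e = {a, b}" "a \<noteq> b" "a \<in> V - {c}" "b \<in> V - {c}"
      using M by (metis card_2_iff insert_subset)
    then show "edge_weight (vdeg (star V c \<union> M)) e = edge_weight (\<lambda>x. vdeg M x + 1) e"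
      using x by (simp add: edge_weight_doubleton)
  qed
  finally show "hso (star V c \<union> M) = (\<Sum>x\<in>V - {c}. degree_weight (real (card V - 1)) (real (vdeg M x + 1)))
      + (\<Sum>e\<in>M. edge_weight (\<lambda>x. vdeg M x + 1) e)" .
qed

lemma cone_if_dominating:
  assumes "finite V" "\<forall>e\<in>E. e \<subseteq> V \<and> card e = 2" "c \<in> V" "vdeg E c = card V - 1"
  obtains M where "E = star V c \<union> M" "\<forall>e\<in>M. e \<subseteq> V - {c} \<and> card e = 2"
    "card E = card V - 1 + card M"
proof
  define M where "M = E - star V c"
  have "{x \<in> V - {c}. {c, x} \<in> E} = V - {c}"
    using assms vdeg_eq_card_nbrs[of E V c] by (intro card_subset_eq) auto
  then have sub: "star V c \<subseteq> E" by (auto simp: star_def)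
  then show "E = star V c \<union> M" by (auto simp: M_def)
  show "\<forall>e\<in>M. e \<subseteq> V - {c} \<and> card e = 2"
  proof
    fix e assume e: "e \<in> M"
    then have e2: "e \<subseteq> V" "card e = 2" using assms by (auto simp: M_def)
    have "c \<notin> e"
    proof
      assume "c \<in> e"
      then obtain x where "e = {c, x}" "c \<noteq> x" using e2 by (metis card_2_iff insertE insert_commute singletonD)
      then show False using e e2 by (auto simp: M_def star_def)
    qed
    then show "e \<subseteq> V - {c} \<and> card e = 2" using e2 by auto
  qed
  have inj: "inj_on (\<lambda>x. {c, x}) (V - {c})" by (auto simp: inj_on_def doubleton_eq_iff)
  have "card (star V c) = card V - 1" using inj assms by (simp add: star_def card_image)
  moreover have "finite E" using assms finite_edges by blast
  ultimately show "card E = card V - 1 + card M"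
    using sub card_mono[of E "star V c"] by (simp add: M_def card_Diff_subset finite_subset)
qed

text \<open>The spokes of \<open>S''\<^sub>n\<close> end in \<open>y\<close> of degree 3, in \<open>z\<close> and \<open>t\<close> of degree 2, and in \<open>n - 4\<close> pendent vertices.\<close>

lemma hso_S_bicyclic:
  assumes "finite V" "is_S_bicyclic V E"
  shows "hso E = extremal_value (real (card V) - 1)"
proof -
  obtain c y z t where d: "distinct [c, y, z, t]" and sub: "{c, y, z, t} \<subseteq> V"
    and E: "E = star V c \<union> {{y, z}, {y, t}}"
    using assms by (auto simp: is_S_bicyclic_def)
  let ?M = "{{y, z}, {y, t}}"
  have V: "V - {c} = insert y (insert z (insert t (V - {c, y, z, t})))" using d sub by auto
  have M: "\<forall>e\<in>?M. e \<subseteq> V - {c} \<and> card e = 2" using d sub by auto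
  have "card {c, y, z, t} = 4" using d by simp
  then have card: "card (V - {c, y, z, t}) = card V - 4" and n: "card V \<ge> 4"
    using sub assms card_mono[of V "{c, y, z, t}"] by (auto simp: card_Diff_subset)
  have "{e \<in> ?M. y \<in> e} = ?M" "{e \<in> ?M. z \<in> e} = {{y, z}}" "{e \<in> ?M. t \<in> e} = {{y, t}}"
    using d by auto
  moreover have "card ?M = 2" using d by (auto simp: card_2_iff doubleton_eq_iff)
  ultimately have dM: "vdeg ?M y = 2" "vdeg ?M z = 1" "vdeg ?M t = 1"
    unfolding vdeg_def by simp_all
  have d0: "vdeg ?M x = 0" if "x \<in> V - {c, y, z, t}" for x
  proof -
    have "{e \<in> ?M. x \<in> e} = {}" using that by auto
    then show ?thesis unfolding vdeg_def by simp
  qed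
  define x where "x = real (card V) - 1"
  have x: "x \<ge> 3" "real (card V - 1) = x" "real (card V - 4) = x - 3"
    using n by (auto simp: x_def of_nat_diff)
  have "(\<Sum>v\<in>V - {c}. degree_weight (real (card V - 1)) (real (vdeg ?M v + 1)))
      = degree_weight x 3 + degree_weight x 2 + degree_weight x 2 + (\<Sum>v\<in>V - {c, y, z, t}. degree_weight x (real (vdeg ?M v + 1)))"
    using d assms(1) dM x by (subst V) (simp add: add_ac)
  also have "(\<Sum>v\<in>V - {c, y, z, t}. degree_weight x (real (vdeg ?M v + 1))) = (\<Sum>v\<in>V - {c, y, z, t}. degree_weight x 1)"
    by (intro sum.cong refl) (simp add: d0)
  also have "\<dots> = (x - 3) * degree_weight x 1" using card x by simp
  finally have 1: "(\<Sum>v\<in>V - {c}. degree_weight (real (card V - 1)) (real (vdeg ?M v + 1)))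
      = degree_weight x 3 + degree_weight x 2 + degree_weight x 2 + (x - 3) * degree_weight x 1" .
  have 2: "(\<Sum>e\<in>?M. edge_weight (\<lambda>x. vdeg ?M x + 1) e) = degree_weight 3 2 + degree_weight 3 2"
    using d dM by (simp add: doubleton_eq_iff edge_weight_doubleton)
  have w: "degree_weight x 3 = sqrt (x\<^sup>2 + 9) / 3" "degree_weight x 2 = sqrt (x\<^sup>2 + 4) / 2" "degree_weight x 1 = sqrt (x\<^sup>2 + 1)"
    "degree_weight 3 2 = sqrt 13 / 2"
    using x by (simp_all add: degree_weight_def)
  show ?thesis
    using hso_cone[OF assms(1) _ M] sub 1 2 w by (simp add: E extremal_value_def flip: x_def)
qed

lemma hso_cone_matching:
  assumes V: "finite V" "{c, y, z, s, t} \<subseteq> V" and d: "distinct [c, y, z, s, t]"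
  shows "hso (star V c \<union> {{y, z}, {s, t}}) < extremal_value (real (card V) - 1)"
proof -
  let ?M = "{{y, z}, {s, t}}"
  have V': "V - {c} = insert y (insert z (insert s (insert t (V - {c, y, z, s, t}))))" using d V by auto
  have M: "\<forall>e\<in>?M. e \<subseteq> V - {c} \<and> card e = 2" using d V by auto
  have "card {c, y, z, s, t} = 5" using d by simp
  then have card: "card (V - {c, y, z, s, t}) = card V - 5" and n: "card V \<ge> 5"
    using V card_mono[of V "{c, y, z, s, t}"] by (auto simp: card_Diff_subset)
  have "{e \<in> ?M. y \<in> e} = {{y, z}}" "{e \<in> ?M. z \<in> e} = {{y, z}}"
    "{e \<in> ?M. s \<in> e} = {{s, t}}" "{e \<in> ?M. t \<in> e} = {{s, t}}"
    using d by auto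
  then have dM: "vdeg ?M y = 1" "vdeg ?M z = 1" "vdeg ?M s = 1" "vdeg ?M t = 1"
    unfolding vdeg_def by simp_all
  have d0: "vdeg ?M x = 0" if "x \<in> V - {c, y, z, s, t}" for x
  proof -
    have "{e \<in> ?M. x \<in> e} = {}" using that by auto
    then show ?thesis unfolding vdeg_def by simp
  qed
  define x where "x = real (card V) - 1"
  have x: "x \<ge> 4" "real (card V - 1) = x" "real (card V - 5) = x - 4"
    using n by (auto simp: x_def of_nat_diff)
  have "(\<Sum>v\<in>V - {c}. degree_weight (real (card V - 1)) (real (vdeg ?M v + 1)))
      = 4 * degree_weight x 2 + (\<Sum>v\<in>V - {c, y, z, s, t}. degree_weight x (real (vdeg ?M v + 1)))"
    using d V dM x by (subst V') (simp add: add_ac)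
  also have "(\<Sum>v\<in>V - {c, y, z, s, t}. degree_weight x (real (vdeg ?M v + 1))) = (\<Sum>v\<in>V - {c, y, z, s, t}. degree_weight x 1)"
    by (intro sum.cong refl) (simp add: d0)
  also have "\<dots> = (x - 4) * degree_weight x 1" using card x by simp
  finally have 1: "(\<Sum>v\<in>V - {c}. degree_weight (real (card V - 1)) (real (vdeg ?M v + 1)))
      = 4 * degree_weight x 2 + (x - 4) * degree_weight x 1" .
  have 2: "(\<Sum>e\<in>?M. edge_weight (\<lambda>x. vdeg ?M x + 1) e) = degree_weight 2 2 + degree_weight 2 2"
    using d dM by (simp add: doubleton_eq_iff edge_weight_doubleton)
  have "sqrt 8 = 2 * sqrt (2::real)" using real_sqrt_mult[of 4 2] by simp
  then have w: "degree_weight x 2 = sqrt (x\<^sup>2 + 4) / 2" "degree_weight x 1 = sqrt (x\<^sup>2 + 1)" "degree_weight 2 2 = sqrt 2"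
    using x by (simp_all add: degree_weight_def)
  show ?thesis
    using hso_cone[OF V(1) _ M] V 1 2 w extremal_value_gt_matching[OF x(1)] by (simp flip: x_def)
qed

text \<open>A vertex adjacent to all others takes up \<open>n - 1\<close> edges. The two remaining ones either share a vertex,
  which gives \<open>S''\<^sub>n\<close>, or are disjoint.\<close>

lemma hso_dominating_vertex:
  assumes "finite V" "\<forall>e\<in>E. e \<subseteq> V \<and> card e = 2" "card E = card V + 1"
    and "c \<in> V" "vdeg E c = card V - 1" "\<not> is_S_bicyclic V E"
  shows "hso E < extremal_value (real (card V) - 1)"
proof -
  obtain M where M: "E = star V c \<union> M" "\<forall>e\<in>M. e \<subseteq> V - {c} \<and> card e = 2"
    "card E = card V - 1 + card M"
    using cone_if_dominating assms by metis
  have "card V > 0" using assms by (auto simp: card_gt_0_iff)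
  then have "card M = 2" using M assms by simp
  then obtain e f where ef: "M = {e, f}" "e \<noteq> f" by (auto simp: card_2_iff)
  have disj: "e \<inter> f = {}"
  proof (rule ccontr)
    assume "e \<inter> f \<noteq> {}"
    then obtain y where y: "y \<in> e" "y \<in> f" by auto
    have "\<exists>z. g = {y, z} \<and> y \<noteq> z" if "g \<in> M" "y \<in> g" for g
      using M(2) that by (metis card_2_iff insertE insert_commute singletonD)
    then obtain z t where zt: "e = {y, z}" "y \<noteq> z" "f = {y, t}" "y \<noteq> t"
      using ef y by (metis insertI1 insertI2)
    then have "distinct [c, y, z, t]" "{c, y, z, t} \<subseteq> V" using M(2) ef assms(4) by auto
    then show False using assms(6) M(1) ef zt by (auto simp: is_S_bicyclic_def)
  qed
  obtain y z where yz: "e = {y, z}" "y \<noteq> z" using M(2) ef by (auto simp: card_2_iff)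
  obtain s t where st: "f = {s, t}" "s \<noteq> t" using M(2) ef by (auto simp: card_2_iff)
  have "distinct [c, y, z, s, t]" "{c, y, z, s, t} \<subseteq> V" using M(2) ef yz st disj assms(4) by auto
  then show ?thesis using hso_cone_matching[OF assms(1), of c y z s t] M(1) ef yz st by simp
qed

section \<open>Deleting a pendent vertex\<close>

text \<open>As the degrees sum to \<open>2 n + 2\<close> and are at least 2, they are at most 4, so the ratio of the degrees of two
  adjacent vertices is at most 2 and no edge weighs more than \<open>sqrt (1 + 2\<^sup>2)\<close>.\<close>

lemma hso_no_pendant:
  assumes E: "finite V" "\<forall>e\<in>E. e \<subseteq> V \<and> card e = 2" and card: "card E = card V + 1" "card V \<ge> 5"
    and deg: "\<forall>v\<in>V. vdeg E v \<ge> 2"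
  shows "hso E < extremal_value (real (card V) - 1)"
proof -
  have le4: "vdeg E v \<le> 4" if v: "v \<in> V" for v
  proof -
    have "2 * card (V - {v}) \<le> (\<Sum>x\<in>V - {v}. vdeg E x)"
      using deg sum_mono[of "V - {v}" "\<lambda>_. 2" "vdeg E"] by (simp add: mult.commute)
    moreover have "vdeg E v + (\<Sum>x\<in>V - {v}. vdeg E x) = 2 * card V + 2"
      using handshake[OF E] card sum.remove[OF E(1) v, of "vdeg E"] by simp
    moreover have "card (V - {v}) = card V - 1" using v by simp
    ultimately show ?thesis using card(2) by linarith
  qed
  have "edge_weight (vdeg E) e \<le> sqrt 5" if e: "e \<in> E" for e
  proof -
    obtain u v where uv: "e = {u, v}" "u \<noteq> v" "u \<in> V" "v \<in> V"
      using E e by (metis card_2_iff insert_subset)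
    have *: "degree_weight a b \<le> sqrt 5" if "a \<le> b" "2 \<le> a" "b \<le> 4" for a b :: real
    proof -
      have "b\<^sup>2 \<le> (2 * a)\<^sup>2" using that by (intro power_mono) auto
      then have "sqrt (a\<^sup>2 + b\<^sup>2) \<le> sqrt (5 * a\<^sup>2)" by simp
      also have "\<dots> = sqrt 5 * a" using that by (simp add: real_sqrt_mult)
      finally show ?thesis using that by (simp add: degree_weight_def divide_le_eq)
    qed
    have "real (vdeg E u) \<le> 4" "real (vdeg E v) \<le> 4" "2 \<le> real (vdeg E u)" "2 \<le> real (vdeg E v)"
      using le4 deg uv by (auto simp: numeral_le_real_of_nat_iff)
    then have "degree_weight (real (vdeg E u)) (real (vdeg E v)) \<le> sqrt 5"
      using *[of "real (vdeg E u)" "real (vdeg E v)"] *[of "real (vdeg E v)" "real (vdeg E u)"]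
        degree_weight_commute[of "real (vdeg E u)"] linear[of "real (vdeg E u)" "real (vdeg E v)"] by auto
    then show ?thesis using uv by (simp add: edge_weight_doubleton)
  qed
  then have "hso E \<le> real (card E) * sqrt 5"
    unfolding hso_def by (intro sum_bounded_above)
  also have "\<dots> < extremal_value (real (card V) - 1)"
    using extremal_value_gt_no_pendant[OF card(2)] card(1) by (simp add: add.commute)
  finally show ?thesis .
qed

lemma connected_delete_pendant:
  assumes E: "connected_graph V E" and e: "{u, v} \<in> E" "u \<noteq> v" and v: "vdeg E v = 1"
  shows "connected_graph (V - {v}) (E - {{u, v}})"
    and "{f \<in> E. v \<in> f} = {{u, v}}"
proof -
  obtain g where "{f \<in> E. v \<in> f} = {g}" using v unfolding vdeg_def by (meson card_1_singletonE)
  moreover have "{u, v} \<in> {f \<in> E. v \<in> f}" using e by simp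
  ultimately show only: "{f \<in> E. v \<in> f} = {{u, v}}" by (metis singletonD)
  then have only': "f = {u, v}" if "f \<in> E" "v \<in> f" for f using that by blast
  have u: "u \<in> V" "v \<in> V" using E e by (auto simp: connected_graph_def)
  show "connected_graph (V - {v}) (E - {{u, v}})"
    unfolding connected_graph_def
  proof (intro conjI allI impI)
    show "finite (V - {v})" using E by (simp add: connected_graph_def)
    show "\<forall>e\<in>E - {{u, v}}. e \<subseteq> V - {v} \<and> card e = 2"
      using E only' unfolding connected_graph_def by blast
    fix S assume S: "S \<subseteq> V - {v}" "S \<noteq> {}" "S \<noteq> V - {v}"
    (* The pendent vertex is put on the side of its neighbour, so that its edge does not cross the cut. *)
    define S' where "S' = (if u \<in> S then insert v S else S)"
    have "S' \<subseteq> V" "S' \<noteq> {}" "S' \<noteq> V" using S u e by (auto simp: S'_def)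
    then obtain f where f: "f \<in> E" "f \<inter> S' \<noteq> {}" "f - S' \<noteq> {}"
      using E unfolding connected_graph_def by metis
    have "f \<noteq> {u, v}" using f(2,3) S(1) by (auto simp: S'_def split: if_splits)
    moreover from this have "v \<notin> f" using f(1) only' by blast
    ultimately show "\<exists>e\<in>E - {{u, v}}. e \<inter> S \<noteq> {} \<and> e - S \<noteq> {}"
      using f by (intro bexI[of _ f]) (auto simp: S'_def split: if_splits)
  qed
qed

text \<open>Otherwise no edge would leave \<open>{u, v}\<close>.\<close>

lemma vdeg_nbr_pendant:
  assumes E: "connected_graph V E" and e: "{u, v} \<in> E" "u \<noteq> v" and v: "vdeg E v = 1"
    and "card V \<ge> 3"
  shows "vdeg E u \<ge> 2"
proof -
  have fE: "finite E" "finite V" using E finite_edges[of V E] by (auto simp: connected_graph_def)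
  have sub: "{u, v} \<subseteq> V" using E e by (auto simp: connected_graph_def)
  have "card {u, v} = 2" using e by simp
  then have "{u, v} \<noteq> V" using assms(5) by auto
  then obtain f where f: "f \<in> E" "f \<inter> {u, v} \<noteq> {}" "f - {u, v} \<noteq> {}"
    using E sub unfolding connected_graph_def by (metis insert_not_empty)
  have "v \<notin> f" using connected_delete_pendant(2)[OF E e v] f by blast
  then have "{f, {u, v}} \<subseteq> {e \<in> E. u \<in> e}" "f \<noteq> {u, v}" using f e by auto
  then show ?thesis
    unfolding vdeg_def using fE card_mono[of "{e \<in> E. u \<in> e}" "{f, {u, v}}"] by simp
qed

text \<open>The deleted edge weighs \<open>sqrt (d\<^sup>2 + 1)\<close>; each of the \<open>d - 1\<close> other edges at \<open>u\<close> loses no more than a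
  pendent edge would, and all other edges keep their weight.\<close>

lemma hso_delete_pendant:
  assumes E: "connected_graph V E" and e: "{u, v} \<in> E" "u \<noteq> v" and v: "vdeg E v = 1"
    and card: "card V \<ge> 3"
  defines "d \<equiv> real (vdeg E u)"
  shows "hso E \<le> hso (E - {{u, v}}) + sqrt (d\<^sup>2 + 1)
    + (d - 1) * (sqrt (d\<^sup>2 + 1) - sqrt ((d - 1)\<^sup>2 + 1))"
proof -
  let ?E = "E - {{u, v}}" and ?g = "sqrt (d\<^sup>2 + 1) - sqrt ((d - 1)\<^sup>2 + 1)"
  have fE: "finite E" using E finite_edges[of V E] by (auto simp: connected_graph_def)
  have only: "{f \<in> E. v \<in> f} = {{u, v}}" by (rule connected_delete_pendant(2)[OF E e v])
  have d2: "vdeg E u \<ge> 2" using vdeg_nbr_pendant[OF E e v card] .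
  have "{f \<in> ?E. u \<in> f} = {f \<in> E. u \<in> f} - {{u, v}}" by auto
  then have card_u: "card {f \<in> ?E. u \<in> f} = vdeg E u - 1"
    using e fE by (simp add: vdeg_def card_Diff_singleton)
  then have deg_u: "vdeg ?E u = vdeg E u - 1" by (simp add: vdeg_def)
  have deg: "vdeg ?E x = vdeg E x" if "x \<noteq> u" "x \<noteq> v" for x
  proof -
    have "{f \<in> ?E. x \<in> f} = {f \<in> E. x \<in> f}" using that by auto
    then show ?thesis by (simp add: vdeg_def)
  qed
  have step: "edge_weight (vdeg E) f \<le> edge_weight (vdeg ?E) f + (if u \<in> f then ?g else 0)"
    if f: "f \<in> ?E" for f
  proof -
    have vf: "v \<notin> f" using f only by blast
    have f2: "card f = 2" "f \<subseteq> V" using f E by (auto simp: connected_graph_def)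
    show ?thesis
    proof (cases "u \<in> f")
      case True
      then obtain x where x: "f = {u, x}" "x \<noteq> u"
        using f2 by (metis card_2_iff insertE insert_commute singletonD)
      have xv: "x \<noteq> v" using x vf by blast
      have "vdeg E x \<ge> 1" using x f2 E card by (intro vdeg_ge_1) auto
      then have "degree_weight d (vdeg E x) - degree_weight (d - 1) (vdeg E x) \<le> ?g"
        using d2 by (intro degree_weight_step) (auto simp: d_def)
      moreover have "edge_weight (vdeg E) f = degree_weight d (vdeg E x)"
        using x by (simp add: edge_weight_doubleton d_def)
      moreover have "edge_weight (vdeg ?E) f = degree_weight (d - 1) (vdeg E x)"
        using x d2 deg[OF x(2) xv] deg_u by (simp add: edge_weight_doubleton d_def of_nat_diff)
      ultimately show ?thesis using True by simp
    next
      case False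
      have "edge_weight (vdeg E) f = edge_weight (vdeg ?E) f"
      proof -
        have *: "vdeg ?E x = vdeg E x" if "x \<in> f" for x using deg[of x] that False vf by metis
        then have "vdeg ?E ` f = vdeg E ` f" by (intro image_cong) auto
        then show ?thesis using * by (simp add: edge_weight_def)
      qed
      then show ?thesis using False by simp
    qed
  qed
  have "hso E = edge_weight (vdeg E) {u, v} + (\<Sum>f\<in>?E. edge_weight (vdeg E) f)"
    unfolding hso_def using fE e by (simp add: sum.remove)
  also have "edge_weight (vdeg E) {u, v} = sqrt (d\<^sup>2 + 1)"
    using e v d2 by (simp add: edge_weight_doubleton degree_weight_def d_def)
  also have "(\<Sum>f\<in>?E. edge_weight (vdeg E) f)
      \<le> (\<Sum>f\<in>?E. edge_weight (vdeg ?E) f + (if u \<in> f then ?g else 0))"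
    by (intro sum_mono step)
  also have "\<dots> = hso ?E + (\<Sum>f\<in>{f \<in> ?E. u \<in> f}. ?g)"
    using fE by (simp add: sum.distrib hso_def flip: sum.inter_filter)
  also have "(\<Sum>f\<in>{f \<in> ?E. u \<in> f}. ?g) = (d - 1) * ?g"
    using card_u d2 by (simp add: d_def of_nat_diff)
  finally show ?thesis by simp
qed

text \<open>Induction on the order. Only a graph with a pendent vertex and without a vertex of degree \<open>n - 1\<close> needs the
  induction hypothesis. There the inequality is strict, so equality only has to be studied for graphs with
  a vertex of degree \<open>n - 1\<close>, and the hypothesis is used for the bound alone.\<close>

lemma hso_le_extremal_value:
  assumes "connected_graph V E" "card E = card V + 1"
  shows "hso E \<le> extremal_value (real (card V) - 1)
    \<and> (\<not> is_S_bicyclic V E \<longrightarrow> hso E < extremal_value (real (card V) - 1))"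
  using assms
proof (induction "card V" arbitrary: V E rule: less_induct)
  case less
  note E = less.prems(1) and card = less.prems(2)
  have fV: "finite V" and E2: "\<forall>e\<in>E. e \<subseteq> V \<and> card e = 2"
    using E by (auto simp: connected_graph_def)
  have n4: "card V \<ge> 4" using bicyclic_card_ge_4[OF E card] .
  (* On four vertices the degree sum is 10, so the degrees cannot all be at most 2. *)
  have n5: "card V \<ge> 5" if small: "\<forall>v\<in>V. vdeg E v < card V - 1"
  proof -
    have "card V \<noteq> 4"
    proof
      assume n: "card V = 4"
      have "(\<Sum>v\<in>V. vdeg E v) \<le> (\<Sum>v\<in>V. 2)"
        using small n by (intro sum_mono) force
      then show False using handshake[OF fV E2] card n by simp
    qed
    then show ?thesis using n4 by simp
  qed
  consider (dominating) c where "c \<in> V" "vdeg E c = card V - 1"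
    | (no_pendant) "\<forall>v\<in>V. vdeg E v < card V - 1" "\<forall>v\<in>V. vdeg E v \<ge> 2"
    | (pendant) v where "\<forall>v\<in>V. vdeg E v < card V - 1" "v \<in> V" "vdeg E v = 1"
  proof -
    have "vdeg E v \<ge> 1" "vdeg E v \<le> card V - 1" if "v \<in> V" for v
      using that n4 vdeg_ge_1[OF E] vdeg_le[OF fV E2] by auto
    then show ?thesis using that by (metis Suc_1 le_antisym le_neq_implies_less not_less_eq_eq One_nat_def)
  qed
  then show ?case
  proof cases
    case dominating
    then show ?thesis
      using hso_dominating_vertex[OF fV E2 card] hso_S_bicyclic[OF fV] by (metis less_eq_real_def)
  next
    case no_pendant
    then have "hso E < extremal_value (real (card V) - 1)"
      using n5 by (intro hso_no_pendant fV E2 card) auto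
    then show ?thesis by simp
  next
    case (pendant v)
    have n5: "card V \<ge> 5" using n5 pendant(1) .
    have "card {e \<in> E. v \<in> e} \<noteq> 0" using pendant(3) by (simp add: vdeg_def)
    then have "{e \<in> E. v \<in> e} \<noteq> {}" by (metis card.empty)
    then obtain u where u: "{u, v} \<in> E" "u \<noteq> v"
      using E2 by (smt (verit) Collect_empty_eq card_2_iff insertE insert_commute singletonD)
    have uV: "u \<in> V" using u E2 by auto
    define x where "x = real (card V) - 1"
    (* The degree k + 1 of u is at most n - 2, so the convexity bound applies to its increment. *)
    define k where "k = vdeg E u - 1"
    have k: "real (vdeg E u) = real k + 1" "k \<le> card V - 3"
      using vdeg_nbr_pendant[OF E u pendant(3)] pendant(1) uV n5 by (auto simp: k_def)
    have x: "x \<ge> 4" "real (card V - 2) = x - 1" "real (card V - 3) = x - 2"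
      using n5 by (auto simp: x_def of_nat_diff)
    let ?E = "E - {{u, v}}" and ?V = "V - {v}"
    let ?s = "sqrt ((real k + 1)\<^sup>2 + 1) - sqrt ((real k)\<^sup>2 + 1)"
    have V': "card ?V = card V - 1" "card ?V < card V" using pendant(2) fV n4 by simp_all
    have "card ?E = card ?V + 1"
      using card u V' finite_edges[OF fV E2] n5 by (simp add: card_Diff_singleton)
    then have IH: "hso ?E \<le> extremal_value (x - 1)"
      using less.hyps[OF V'(2) connected_delete_pendant(1)[OF E u pendant(3)]] V' n5
      by (simp add: x_def of_nat_diff)
    have "hso E \<le> hso ?E + sqrt ((real k + 1)\<^sup>2 + 1) + real k * ?s"
      using hso_delete_pendant[OF E u pendant(3)] n5 k by simp
    also have "\<dots> \<le> extremal_value (x - 1) + sqrt ((x - 1)\<^sup>2 + 1) + (x - 2) * (sqrt (x\<^sup>2 + 1) - sqrt ((x - 1)\<^sup>2 + 1))"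
    proof (intro add_mono mult_mono IH)
      show "real k \<le> x - 2" using k x by linarith
      then show "sqrt ((real k + 1)\<^sup>2 + 1) \<le> sqrt ((x - 1)\<^sup>2 + 1)" 
        by (auto intro!: power_mono)
      show "?s \<le> sqrt (x\<^sup>2 + 1) - sqrt ((x - 1)\<^sup>2 + 1)"
        using sqrt_step_mono[of k "card V - 2"] k x by (simp add: algebra_simps)
      show "0 \<le> ?s" by (simp add: power_mono)
    qed (use x in auto)
    also have "\<dots> < extremal_value x" using extremal_value_step x by simp
    finally show ?thesis by (simp add: x_def)
  qed
qed

section \<open>Passing to graphs given by arcs\<close>

text \<open>Since every edge is represented by two opposite arcs, the arcs leaving \<open>v\<close> correspond to the edges
  containing \<open>v\<close>, so the out-degree is the number of these edges.\<close>

lemma bicyclic_graph_edges: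
  assumes "bicyclic_graph G n"
  shows "connected_graph (pverts G) (edges G)" "card (pverts G) = n" "card (edges G) = n + 1"
    "HSO G = hso (edges G)"
proof -
  interpret pair_graph G using assms by (simp add: bicyclic_graph_def)
  show "card (pverts G) = n" "card (edges G) = n + 1" using assms by (simp_all add: bicyclic_graph_def)
  have sym: "(v, u) \<in> parcs G" if "(u, v) \<in> parcs G" for u v
    using that pair_sym_arcs by (auto simp: symmetric_def dest: symD)
  have reach: "u \<rightarrow>\<^sup>*\<^bsub>mk_symmetric G\<^esub> v" if "u \<in> pverts G" "v \<in> pverts G" for u v
    using assms that by (auto simp: bicyclic_graph_def connected_def)
  have ends: "parcs (mk_symmetric G) = parcs G"
    using adj_mk_symmetric_eq[OF pair_sym_arcs] by simp
  have sub: "\<forall>e\<in>edges G. e \<subseteq> pverts G \<and> card e = 2"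
    unfolding edges_def using in_arcsD1 in_arcsD2 pair_no_loops by fastforce
  show "connected_graph (pverts G) (edges G)"
    unfolding connected_graph_def
  proof (intro conjI allI impI)
    show "finite (pverts G)" by (rule pair_finite_verts)
    show "\<forall>e\<in>edges G. e \<subseteq> pverts G \<and> card e = 2" by (rule sub)
    fix S assume S: "S \<subseteq> pverts G" "S \<noteq> {}" "S \<noteq> pverts G"
    then obtain u v where uv: "u \<in> S" "v \<in> pverts G" "v \<notin> S" by auto
    then have "(u, v) \<in> (parcs G)\<^sup>*"
      using reachable_rtranclI[OF reach[of u v]] S(1) by (auto simp: ends)
    (* A walk from S to its complement has a first arc that leaves S. *)
    then have "\<exists>a b. (a, b) \<in> parcs G \<and> a \<in> S \<and> b \<notin> S"
      using uv(1,3) by (induction rule: rtrancl_induct) auto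
    then obtain a b where "(a, b) \<in> parcs G" "a \<in> S" "b \<notin> S" by blast
    then show "\<exists>e\<in>edges G. e \<inter> S \<noteq> {} \<and> e - S \<noteq> {}"
      by (intro bexI[of _ "{a, b}"]) (auto simp: edges_def)
  qed
  have "degree G v = vdeg (edges G) v" for v
  proof -
    have "out_arcs (with_proj G) v = (\<lambda>x. (v, x)) ` {x \<in> pverts G - {v}. {v, x} \<in> edges G}"
      using sym in_arcsD2 pair_no_loops
      by (fastforce simp: out_arcs_def edges_def doubleton_eq_iff)
    then show ?thesis
      using vdeg_eq_card_nbrs[OF sub]
      by (simp add: degree_def out_degree_def card_image inj_on_def)
  qed
  then have "degree G = vdeg (edges G)" by blast
  then show "HSO G = hso (edges G)" by (simp add: HSO_def hso_def edge_weight_def)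
qed

text \<open>Arcs are pairs of vertices, so the arc part of an isomorphism is determined by its vertex part.\<close>

lemma graph_iso_iff:
  assumes "pair_graph G"
  shows "graph_iso G H \<longleftrightarrow>
    (\<exists>f. inj_on f (pverts G) \<and> pverts H = f ` pverts G \<and> parcs H = map_prod f f ` parcs G)"
proof
  interpret pair_graph G by fact
  assume "graph_iso G H"
  then obtain h where h: "pre_digraph.digraph_isomorphism (with_proj G) h" "with_proj H = app_iso h (with_proj G)"
    by (auto simp: digraph_iso_def)
  have V: "pverts H = iso_verts h ` pverts G" and A: "parcs H = iso_arcs h ` parcs G"
    and ht: "fst = iso_tail h" "snd = iso_head h"
    using arg_cong[OF h(2), of verts] arg_cong[OF h(2), of arcs]
      arg_cong[OF h(2), of tail] arg_cong[OF h(2), of head] by simp_all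
  have "iso_arcs h a = map_prod (iso_verts h) (iso_verts h) a" if "a \<in> parcs G" for a
    using h(1) that ht[symmetric] by (cases a) (auto simp: digraph_isomorphism_def prod_eq_iff)
  then have "parcs H = map_prod (iso_verts h) (iso_verts h) ` parcs G"
    unfolding A by (intro image_cong) auto
  then show "\<exists>f. inj_on f (pverts G) \<and> pverts H = f ` pverts G \<and> parcs H = map_prod f f ` parcs G"
    using V h(1) by (auto simp: digraph_isomorphism_def)
next
  interpret pair_graph G by fact
  assume "\<exists>f. inj_on f (pverts G) \<and> pverts H = f ` pverts G \<and> parcs H = map_prod f f ` parcs G"
  then obtain f where f: "inj_on f (pverts G)" "pverts H = f ` pverts G" "parcs H = map_prod f f ` parcs G"
    by blast
  let ?h = "\<lparr>iso_verts = f, iso_arcs = map_prod f f, iso_head = snd, iso_tail = fst\<rparr>"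
  have "inj_on (map_prod f f) (parcs G)"
  proof (rule inj_on_subset)
    show "inj_on (map_prod f f) (pverts G \<times> pverts G)" using f(1) by (rule map_prod_inj_on) fact
    show "parcs G \<subseteq> pverts G \<times> pverts G" using in_arcsD1 in_arcsD2 by auto
  qed
  then have "pre_digraph.digraph_isomorphism (with_proj G) ?h"
    using f(1) wf_digraph_axioms by (auto simp: digraph_isomorphism_def)
  moreover have "with_proj H = app_iso ?h (with_proj G)"
    using f by (simp add: app_iso_def with_proj_def)
  ultimately show "graph_iso G H" unfolding digraph_iso_def by blast
qed

lemma edges_eq_image: "edges G = (\<lambda>p. {fst p, snd p}) ` parcs G"
  by (force simp: edges_def image_iff)

lemma parcs_iff_edges:
  assumes "sym (parcs G)"
  shows "(u, v) \<in> parcs G \<longleftrightarrow> {u, v} \<in> edges G"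
  using assms by (auto simp: edges_def doubleton_eq_iff dest: symD)

text \<open>A symmetric arc relation is determined by its edges.\<close>

lemma parcs_image_iff_edges_image:
  assumes G: "sym (parcs G)" and H: "sym (parcs H)"
  shows "parcs H = map_prod f f ` parcs G \<longleftrightarrow> edges H = (`) f ` edges G"
proof
  assume "parcs H = map_prod f f ` parcs G"
  then show "edges H = (`) f ` edges G"
    by (simp add: edges_eq_image image_image)
next
  assume E: "edges H = (`) f ` edges G"
  have fwd: "(f u, f v) \<in> parcs H" if "(u, v) \<in> parcs G" for u v
  proof -
    have "f ` {u, v} \<in> edges H" unfolding E using that parcs_iff_edges[OF G] by blast
    then show ?thesis by (simp add: parcs_iff_edges[OF H])
  qed
  have bwd: "(a, b) \<in> map_prod f f ` parcs G" if "(a, b) \<in> parcs H" for a b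
  proof -
    have "{a, b} \<in> (`) f ` edges G" using that E parcs_iff_edges[OF H] by blast
    then obtain u v where uv: "(u, v) \<in> parcs G" "{a, b} = f ` {u, v}"
      unfolding edges_def by blast
    then have "(v, u) \<in> parcs G" using symD[OF G] by blast
    moreover have "(a, b) = map_prod f f (u, v) \<or> (a, b) = map_prod f f (v, u)"
      using uv(2) by (simp add: doubleton_eq_iff)
    ultimately show ?thesis using uv(1) by blast
  qed
  show "parcs H = map_prod f f ` parcs G"
  proof (rule subset_antisym)
    show "parcs H \<subseteq> map_prod f f ` parcs G" using bwd by (rule subrelI)
    show "map_prod f f ` parcs G \<subseteq> parcs H" using fwd by auto
  qed
qed

lemma S_bicyclic_structure:
  assumes "n \<ge> 4"
  shows "pverts (S_bicyclic n) = {..<n}" "sym (parcs (S_bicyclic n))"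
    "edges (S_bicyclic n) = star {..<n} 0 \<union> {{1, 2}, {1, 3}}"
proof -
  show "pverts (S_bicyclic n) = {..<n}"
    using assms by (auto simp: S_bicyclic_def attach_pendent_def K4_minus_edge_def)
  show sym: "sym (parcs (S_bicyclic n))"
    by (auto simp: S_bicyclic_def attach_pendent_def K4_minus_edge_def sym_def insert_commute)
  have "parcs K4_minus_edge = {(0,1),(1,0),(0,2),(2,0),(0,3),(3,0),(1,2),(2,1),(1,3),(3,1)}"
    unfolding K4_minus_edge_def by (auto simp: doubleton_eq_iff)
  then have "parcs (S_bicyclic n) =
      {(0,1),(1,0),(0,2),(2,0),(0,3),(3,0),(1,2),(2,1),(1,3),(3,1)} \<union> {0} \<times> {4..<n} \<union> {4..<n} \<times> {0}"
    by (simp add: S_bicyclic_def attach_pendent_def)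
  then have "edges (S_bicyclic n) =
      {{0, 1}, {0, 2}, {0, 3}, {1, 2}, {1, 3}} \<union> (\<lambda>x. {0, x}) ` {4..<n}"
  proof -
    have pendent: "(\<lambda>p. {fst p, snd p}) ` ({0} \<times> W) = (\<lambda>x. {0, x}) ` W"
      "(\<lambda>p. {fst p, snd p}) ` (W \<times> {0}) = (\<lambda>x. {0, x}) ` W" for W :: "nat set"
      by (auto simp: image_iff insert_commute)
    show ?thesis
      unfolding edges_eq_image \<open>parcs (S_bicyclic n) = _\<close> image_Un pendent by (simp add: insert_commute)
  qed
  moreover have "{..<n} - {0} = {1, 2, 3} \<union> {4..<n}" using assms by auto
  ultimately show "edges (S_bicyclic n) = star {..<n} 0 \<union> {{1, 2}, {1, 3}}"
    by (simp add: star_def image_Un insert_commute Un_ac)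
qed

lemma star_image:
  assumes "inj_on f V" "c \<in> V"
  shows "(`) f ` star V c = star (f ` V) (f c)"
proof -
  have "f ` V - {f c} = f ` (V - {c})" using assms by (auto simp: inj_on_def)
  then show ?thesis by (simp add: star_def image_image)
qed

lemma graph_iso_S_bicyclic_iff:
  assumes "bicyclic_graph G n"
  shows "graph_iso G (S_bicyclic n) \<longleftrightarrow> is_S_bicyclic (pverts G) (edges G)"
proof -
  let ?V = "pverts G" and ?E = "edges G" and ?S = "S_bicyclic n"
  note G = bicyclic_graph_edges[OF assms]
  have pg: "pair_graph G" using assms by (simp add: bicyclic_graph_def)
  have n: "n \<ge> 4" using bicyclic_card_ge_4[OF G(1)] G by simp
  note S = S_bicyclic_structure[OF n]
  have fV: "finite ?V" and sub: "\<forall>e\<in>?E. e \<subseteq> ?V" using G(1) by (auto simp: connected_graph_def)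
  have "sym (parcs G)"
  proof -
    interpret pair_graph G by (rule pg)
    show ?thesis using pair_sym_arcs by (simp add: symmetric_def)
  qed
  then have iso: "graph_iso G ?S \<longleftrightarrow>
      (\<exists>f. inj_on f ?V \<and> {..<n} = f ` ?V \<and> edges ?S = (`) f ` ?E)"
    using graph_iso_iff[OF pg] parcs_image_iff_edges_image S by metis
  show ?thesis
  proof
    assume "graph_iso G ?S"
    then obtain f where f: "inj_on f ?V" "f ` ?V = {..<n}" "edges ?S = (`) f ` ?E"
      using iso by metis
    define g where "g = the_inv_into ?V f"
    have g: "inj_on g {..<n}" "g ` {..<n} = ?V"
      using f(1,2) inj_on_the_inv_into[of f ?V] the_inv_into_onto[of f ?V] by (simp_all add: g_def)
    have "g ` f ` e = e" if "e \<in> ?E" for e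
    proof -
      have "g (f x) = x" if "x \<in> e" for x
        unfolding g_def using that \<open>e \<in> ?E\<close> sub f(1) by (intro the_inv_into_f_f) auto
      then show ?thesis by force
    qed
    then have "?E = (`) g ` edges ?S" using f(3) by (force simp: image_image)
    also have "\<dots> = star ?V (g 0) \<union> {{g 1, g 2}, {g 1, g 3}}"
      using star_image[OF g(1), of 0] g(2) n by (simp add: S image_Un)
    finally have "?E = star ?V (g 0) \<union> {{g 1, g 2}, {g 1, g 3}}" .
    moreover have "distinct [g 0, g 1, g 2, g 3]"
      using n by (simp add: inj_on_eq_iff[OF g(1)])
    moreover have "{g 0, g 1, g 2, g 3} \<subseteq> ?V" using g(2) n by auto
    ultimately show "is_S_bicyclic ?V ?E" unfolding is_S_bicyclic_def by blast
  next
    assume "is_S_bicyclic ?V ?E"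
    then obtain c y z t where d: "distinct [c, y, z, t]" and V: "{c, y, z, t} \<subseteq> ?V"
      and E: "?E = star ?V c \<union> {{y, z}, {y, t}}"
      unfolding is_S_bicyclic_def by blast
    have "card {c, y, z, t} = 4" using d by simp
    then have "card (?V - {c, y, z, t}) = card {4..<n}"
      using V fV G(2) by (simp add: card_Diff_subset)
    then obtain h where h: "bij_betw h (?V - {c, y, z, t}) {4..<n}"
      using fV by (metis bij_betw_iff_card finite_Diff finite_atLeastLessThan)
    define f where "f = h(c := 0, y := 1, z := 2, t := 3)"
    have fv: "f c = 0" "f y = 1" "f z = 2" "f t = 3" using d by (auto simp: f_def)
    have "bij_betw f (?V - {c, y, z, t}) {4..<n}"
      using h by (rule bij_betw_cong[THEN iffD1, rotated]) (auto simp: f_def)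
    moreover have "bij_betw f {c, y, z, t} {0, 1, 2, 3}"
      using d fv by (auto simp: bij_betw_def)
    ultimately have "bij_betw f ((?V - {c, y, z, t}) \<union> {c, y, z, t}) ({4..<n} \<union> {0, 1, 2, 3})"
      by (rule bij_betw_combine) auto
    moreover have "(?V - {c, y, z, t}) \<union> {c, y, z, t} = ?V" using V by auto
    moreover have "{4..<n} \<union> {0, 1, 2, 3} = {..<n}" using n by auto
    ultimately have "bij_betw f ?V {..<n}" by (simp only:)
    then have f: "inj_on f ?V" "f ` ?V = {..<n}" unfolding bij_betw_def by blast+
    have c: "c \<in> ?V" using V by simp
    have "(`) f ` ?E = (`) f ` star ?V c \<union> {{f y, f z}, {f y, f t}}"
      by (subst E) (simp add: image_Un)
    also have "\<dots> = edges ?S" unfolding star_image[OF f(1) c] f(2) fv S(3) ..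
    finally show "graph_iso G ?S" using f unfolding iso by (intro exI[of _ f]) simp
  qed
qed

theorem theorem3p4:
  fixes G :: "'a pair_pre_digraph" and n :: nat
  assumes "bicyclic_graph G n"
  shows "HSO G \<le> (real n - 4) * sqrt ((real n)\<^sup>2 - 2 * real n + 2)
               + sqrt ((real n)\<^sup>2 - 2 * real n + 5)
               + 1 / 3 * sqrt ((real n)\<^sup>2 - 2 * real n + 10) + sqrt 13
    \<and> (HSO G = (real n - 4) * sqrt ((real n)\<^sup>2 - 2 * real n + 2)
               + sqrt ((real n)\<^sup>2 - 2 * real n + 5)
               + 1 / 3 * sqrt ((real n)\<^sup>2 - 2 * real n + 10) + sqrt 13
         \<longleftrightarrow> graph_iso G (S_bicyclic n))"
proof -
  note G = bicyclic_graph_edges[OF assms]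
  have rhs: "(real n - 4) * sqrt ((real n)\<^sup>2 - 2 * real n + 2)
               + sqrt ((real n)\<^sup>2 - 2 * real n + 5)
               + 1 / 3 * sqrt ((real n)\<^sup>2 - 2 * real n + 10) + sqrt 13 = extremal_value (real n - 1)"
    by (simp add: extremal_value_def power2_eq_square algebra_simps)
  have fV: "finite (pverts G)" using G(1) by (simp add: connected_graph_def)
  have card: "card (edges G) = card (pverts G) + 1" using G(2,3) by simp
  have "hso (edges G) \<le> extremal_value (real n - 1) \<and>
      (hso (edges G) = extremal_value (real n - 1) \<longleftrightarrow> is_S_bicyclic (pverts G) (edges G))"
    using hso_le_extremal_value[OF G(1) card] hso_S_bicyclic[OF fV, of "edges G"]
    unfolding G(2) by (metis order.strict_implies_not_eq)
  then show ?thesis unfolding rhs G(4) graph_iso_S_bicyclic_iff[OF assms] .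
qed

end
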